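(* Let $c$ be a nonnegative integer and let $T(c)$ be the tree described in the context, which has $n=c+4$ elements. The orbits of $\partial_K$ acting on $\mathcal{L}_m(T(c))$ are as follows. (a) For $m=n-2$, there is exactly one orbit, and it has size $m-1$. (b) For $m=n-1$: (i) if $c$ is even, there are exactly $3$ orbits, each of size $m-1$; (ii) if $c$ is odd, there are exactly $2$ orbits, one of size $m-1$ and one of size $2(m-1)$. (c) For $m=n$: (i) if $c$ is even, there are exactly $2$ orbits, each of size $m-1$; (ii) if $c$ is odd, there is exactly one orbit, of size $2(m-1)$.
   Context: $T(c)$ is the poset formed from a chain $\hat0\lessdot x_1\lessdot x_2\lessdot\cdots\lessdot x_c$ (of length $c$, i.e. with $c+1$ elements; its top element is $x_c$, or $\hat0$ if $c=0$) by adding two new maximal elements $u,v$ both covering the top element of the chain, and one new maximal element $w$ covering $\hat0$. For a positive integer $m$, an $m$-packed labeling of a finite poset $P$ is a surjection $L:P\to\{1,\dots,m\}$ such that $x<_P y$ implies $L(x)<L(y)$; $\mathcal{L}_m(P)$ is the set of them. $K$-promotion $\partial_K:\mathcal{L}_m(P)\to\mathcal{L}_m(P)$: given $L$, erase the labels of all elements labeled $1$; then for $i=2,\dots,m$ in turn, for every cover relation $x\lessdot y$ with $x$ currently unlabeled and $y$ currently labeled $i$, give $x$ label $i$ and erase the label of $y$ (simultaneously for all such pairs); finally decrease every existing label by $1$ and label every unlabeled element $m$. This is a bijection of $\mathcal{L}_m(P)$, and orbits are those of the cyclic group it generates. *)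

theory Defs
  imports "HOL-Algebra.Elementary_Groups" "HOL-Algebra.Group_Action"
begin

text \<open>A poset is given by its carrier \<open>P\<close> and its reflexive order relation \<open>r\<close>, with
  \<^prop>\<open>partial_order_on P r\<close>.\<close>

definition covers :: "'a rel \<Rightarrow> 'a \<Rightarrow> 'a \<Rightarrow> bool" where
  "covers r x y \<longleftrightarrow> (x, y) \<in> r \<and> x \<noteq> y \<and> (\<forall>z. (x, z) \<in> r \<and> (z, y) \<in> r \<longrightarrow> z = x \<or> z = y)"

definition packed_labelings :: "'a set \<Rightarrow> 'a rel \<Rightarrow> nat \<Rightarrow> ('a \<Rightarrow> nat) set" where
  "packed_labelings P r m =
     {L \<in> P \<rightarrow>\<^sub>E {1..m}. L ` P = {1..m} \<and> (\<forall>x\<in>P. \<forall>y\<in>P. (x, y) \<in> r \<and> x \<noteq> y \<longrightarrow> L x < L y)}"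

text \<open>The intermediate stages of promotion are partial labelings, where \<^const>\<open>None\<close> means
  unlabeled.\<close>

definition promo_step :: "'a set \<Rightarrow> 'a rel \<Rightarrow> nat \<Rightarrow> ('a \<Rightarrow> nat option) \<Rightarrow> ('a \<Rightarrow> nat option)" where
  "promo_step P r i M = (\<lambda>x.
     if x \<in> P \<and> M x = None \<and> (\<exists>y\<in>P. covers r x y \<and> M y = Some i) then Some i
     else if M x = Some i \<and> (\<exists>z\<in>P. covers r z x \<and> M z = None) then None
     else M x)"

definition K_promotion :: "'a set \<Rightarrow> 'a rel \<Rightarrow> nat \<Rightarrow> ('a \<Rightarrow> nat) \<Rightarrow> ('a \<Rightarrow> nat)" where
  "K_promotion P r m L =
     (let M\<^sub>1 = (\<lambda>x. if x \<in> P \<and> L x \<noteq> 1 then Some (L x) else None);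
          M = fold (promo_step P r) [2..<Suc m] M\<^sub>1
      in (\<lambda>x\<in>P. case M x of None \<Rightarrow> m | Some k \<Rightarrow> k - 1))"

text \<open>The orbits of the cyclic subgroup that K-promotion generates in the group of
  bijections of the set of \<open>m\<close>-packed labelings. Elements of \<^const>\<open>BijGroup\<close> are extensional
  functions, hence the restriction.\<close>

definition promotion_orbits :: "'a set \<Rightarrow> 'a rel \<Rightarrow> nat \<Rightarrow> ('a \<Rightarrow> nat) set set" where
  "promotion_orbits P r m =
     (let S = packed_labelings P r m
      in orbits (subgroup_generated (BijGroup S) {\<lambda>L\<in>S. K_promotion P r m L}) S (\<lambda>g. g))"

text \<open>\<open>Chain 0\<close> is the bottom element of the tree and \<open>Chain i\<close> is \<open>x\<^sub>i\<close> for \<open>1 \<le> i \<le> c\<close>.\<close>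

datatype tree_elem = Chain nat | U | V | W

definition T_carrier :: "nat \<Rightarrow> tree_elem set" where
  "T_carrier c = Chain ` {0..c} \<union> {U, V, W}"

definition T_hasse :: "nat \<Rightarrow> tree_elem rel" where
  "T_hasse c = {(Chain i, Chain (Suc i)) | i. i < c} \<union> {(Chain c, U), (Chain c, V), (Chain 0, W)}"

definition T_order :: "nat \<Rightarrow> tree_elem rel" where
  "T_order c = {(x, y). x \<in> T_carrier c \<and> y \<in> T_carrier c \<and> (x, y) \<in> (T_hasse c)\<^sup>*}"

lemma T_order_iff:
  "(x, y) \<in> T_order c \<longleftrightarrow> x \<in> T_carrier c \<and> y \<in> T_carrier c \<and>
     (x = y \<or> (\<exists>i. x = Chain i \<and> (y = U \<or> y = V \<or> (\<exists>j\<ge>i. y = Chain j))) \<or> (x = Chain 0 \<and> y = W))"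
proof -
  have up: "(Chain i, Chain j) \<in> (T_hasse c)\<^sup>*" if "i \<le> j" "j \<le> c" for i j
    using that
  proof (induction j rule: dec_induct)
    case (step j)
    have "(Chain j, Chain (Suc j)) \<in> T_hasse c" using step by (auto simp: T_hasse_def)
    with step show ?case by (meson Suc_leD rtrancl.rtrancl_into_rtrancl)
  qed simp
  have top: "(Chain c, U) \<in> T_hasse c" "(Chain c, V) \<in> T_hasse c" "(Chain 0, W) \<in> T_hasse c"
    by (auto simp: T_hasse_def)
  have "(Chain i, U) \<in> (T_hasse c)\<^sup>*" "(Chain i, V) \<in> (T_hasse c)\<^sup>*" if "i \<le> c" for i
    using up[OF that] top by (meson order_refl rtrancl.rtrancl_into_rtrancl)+
  note leaves = this
  have "x = y \<or> (\<exists>i. x = Chain i \<and> (y = U \<or> y = V \<or> (\<exists>j\<ge>i. y = Chain j))) \<or> (x = Chain 0 \<and> y = W)"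
    if "(x, y) \<in> (T_hasse c)\<^sup>*"
    using that by (induction rule: rtrancl_induct) (auto simp: T_hasse_def)
  moreover have "(x, y) \<in> (T_hasse c)\<^sup>*"
    if "x \<in> T_carrier c" "y \<in> T_carrier c"
      "x = y \<or> (\<exists>i. x = Chain i \<and> (y = U \<or> y = V \<or> (\<exists>j\<ge>i. y = Chain j))) \<or> (x = Chain 0 \<and> y = W)"
    using that up leaves top by (auto simp: T_carrier_def)
  ultimately show ?thesis by (auto simp: T_order_def)
qed

lemma T_partial_order: "partial_order_on (T_carrier c) (T_order c)"
  unfolding partial_order_on_def preorder_on_def refl_on_def trans_def antisym_def T_order_iff
  by (auto simp: T_order_iff)

lemma T_covers: "covers (T_order c) x y \<longleftrightarrow> (x, y) \<in> T_hasse c"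
proof
  assume cov: "covers (T_order c) x y"
  then have xy: "(x, y) \<in> T_order c" "x \<noteq> y" by (auto simp: covers_def)
  then have "(x, y) \<in> (T_hasse c)\<^sup>+" by (auto simp: T_order_def rtrancl_eq_or_trancl)
  then obtain z where z: "(x, z) \<in> T_hasse c" "(z, y) \<in> (T_hasse c)\<^sup>*"
    by (meson tranclD)
  then have "z \<in> T_carrier c" "x \<noteq> z" by (auto simp: T_hasse_def T_carrier_def)
  with z xy have "(x, z) \<in> T_order c" "(z, y) \<in> T_order c" by (auto simp: T_order_def)
  with cov \<open>x \<noteq> z\<close> have "z = y" by (auto simp: covers_def)
  with z show "(x, y) \<in> T_hasse c" by simp
next
  assume "(x, y) \<in> T_hasse c"
  then show "covers (T_order c) x y"
    by (auto simp: covers_def T_order_iff T_hasse_def T_carrier_def)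
qed

end

theory Submission
  imports Defs
begin

text \<open>A packed labeling with \<open>m \<ge> c + 2\<close> is almost determined by the label \<open>k \<in> {2..m}\<close> of \<open>W\<close> and
  the relative order of the labels of \<open>U\<close> and \<open>V\<close>. Promotion decreases \<open>k\<close> cyclically; the chain
  takes the smaller of the labels of \<open>U\<close> and \<open>V\<close>, so their order is swapped, except when \<open>W\<close> alone
  carries the label \<open>2\<close>: then only \<open>W\<close> is relabeled. For \<open>m = c + 3\<close> with distinct labels on \<open>U\<close> and
  \<open>V\<close> this gives \<open>c + 2\<close> swaps in \<open>m - 1\<close> steps, and for \<open>m = c + 4\<close> it again gives \<open>c + 2\<close>, so the
  order returns after \<open>m - 1\<close> steps exactly if \<open>c\<close> is even.\<close>

section \<open>Orbits of a cyclic group of bijections\<close>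

lemma funpow_in_cycle:
  assumes "A = (\<lambda>t. (f ^^ t) x) ` {..<p}" "p > 0" "(f ^^ p) x = x"
  shows "f ` A = A"
proof -
  have "f ` A = (\<lambda>t. (f ^^ t) x) ` (Suc ` {..<p})"
    unfolding assms(1) by (simp add: image_image)
  also have "Suc ` {..<p} = insert p ({..<p} - {0})"
    using assms(2) unfolding lessThan_atLeast0 image_Suc_atLeastLessThan by auto
  also have "(\<lambda>t. (f ^^ t) x) ` \<dots> = (\<lambda>t. (f ^^ t) x) ` insert 0 ({..<p} - {0})"
    by (simp only: image_insert assms(3) funpow_0)
  also have "insert 0 ({..<p} - {0}) = {..<p}" using assms(2) by auto
  finally show ?thesis using assms(1) by simp
qed

text \<open>Each member of \<open>C\<close> is invariant under the generator and its inverse, hence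
  under the whole generated group, while powers of \<open>f\<close> already join any two of its
  points. So the members of \<open>C\<close> are exactly the orbits.\<close>

lemma orbits_cyclic:
  fixes f :: "'a \<Rightarrow> 'a"
  assumes "finite S" "\<Union>C = S"
    and cyc: "\<And>A. A \<in> C \<Longrightarrow> \<exists>x p. p > 0 \<and> A = (\<lambda>t. (f ^^ t) x) ` {..<p} \<and> (f ^^ p) x = x"
  shows "orbits (subgroup_generated (BijGroup S) {\<lambda>x\<in>S. f x}) S (\<lambda>g. g) = C"
proof -
  define \<sigma> where "\<sigma> = (\<lambda>x\<in>S. f x)"
  let ?G = "BijGroup S"
  let ?H = "subgroup_generated ?G {\<sigma>}"
  interpret G: group ?G by (rule group_BijGroup)
  have fA: "f ` A = A" if "A \<in> C" for A
    using cyc[OF that] funpow_in_cycle by metis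
  have AS: "A \<subseteq> S" if "A \<in> C" for A using that assms(2) by auto
  have "f ` S = S"
    using fA unfolding assms(2)[symmetric] image_Union by auto
  \<comment> \<open>On a finite set surjectivity gives injectivity, so \<open>f\<close> restricted
    to \<open>S\<close> lies in \<open>BijGroup S\<close>.\<close>
  moreover have "inj_on f S"
    using \<open>f ` S = S\<close> \<open>finite S\<close> by (simp add: eq_card_imp_inj_on)
  ultimately have "bij_betw f S S" by (simp add: bij_betw_def)
  then have \<sigma>: "\<sigma> \<in> carrier ?G"
    unfolding \<sigma>_def BijGroup_def Bij_def by (simp add: bij_betw_restrict_eq)
  have \<sigma>A: "\<sigma> ` A = A" if "A \<in> C" for A
  proof -
    have "\<sigma> ` A = f ` A" by (rule image_cong) (use AS[OF that] in \<open>auto simp: \<sigma>_def\<close>)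
    with fA[OF that] show ?thesis by simp
  qed
  have carr: "carrier ?H = generate ?G {\<sigma>}"
    using \<sigma> by (simp add: carrier_subgroup_generated)
  have mult: "g \<otimes>\<^bsub>?G\<^esub> h = compose S g h" if "g \<in> carrier ?G" "h \<in> carrier ?G" for g h
    using that by (simp add: BijGroup_def)
  \<comment> \<open>The inverse stays in \<open>A\<close> because \<sigma> maps \<open>A\<close>
    onto \<open>A\<close>, not merely into it.\<close>
  have gen: "g ` A \<subseteq> A" if "A \<in> C" "g \<in> generate ?G {\<sigma>}" for A g
    using that(2)
  proof induction
    case one
    then show ?case using AS[OF that(1)] by (auto simp: BijGroup_def)
  next
    case (incl h)
    then show ?case using \<sigma>A[OF that(1)] by simp
  next
    case (inv h)
    have "(inv\<^bsub>?G\<^esub> \<sigma>) y \<in> A" if "y \<in> A" for y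
    proof -
      from that obtain x where x: "x \<in> A" "y = \<sigma> x" using \<sigma>A[OF \<open>A \<in> C\<close>] by blast
      have "(inv\<^bsub>?G\<^esub> \<sigma> \<otimes>\<^bsub>?G\<^esub> \<sigma>) x = x"
        using G.l_inv[OF \<sigma>] AS[OF \<open>A \<in> C\<close>] x(1) by (auto simp: BijGroup_def)
      then show ?thesis
        using x AS[OF \<open>A \<in> C\<close>] by (auto simp: mult \<sigma> compose_def)
    qed
    with inv show ?case by auto
  next
    case (eng g h)
    then have "g \<in> carrier ?G" "h \<in> carrier ?G"
      using G.generate_in_carrier[of "{\<sigma>}"] \<sigma> by auto
    then show ?case using eng.IH AS[OF that(1)] by (auto simp: mult compose_def)
  qed
  have pow: "(\<lambda>x\<in>S. (f ^^ t) x) \<in> generate ?G {\<sigma>} \<and> (\<forall>x\<in>S. (f ^^ t) x \<in> S)" for t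
  proof (induction t)
    case 0
    have "(\<lambda>x\<in>S. x) = \<one>\<^bsub>?G\<^esub>" by (simp add: BijGroup_def)
    then show ?case using generate.one[of ?G "{\<sigma>}"] by simp
  next
    case (Suc t)
    let ?g = "\<lambda>x\<in>S. (f ^^ t) x"
    have "\<sigma> \<otimes>\<^bsub>?G\<^esub> ?g \<in> generate ?G {\<sigma>}"
      by (rule generate.eng[OF generate.incl conjunct1[OF Suc.IH]]) simp
    moreover have "\<sigma> \<otimes>\<^bsub>?G\<^esub> ?g = (\<lambda>x\<in>S. (f ^^ Suc t) x)"
    proof -
      have "?g \<in> carrier ?G" using Suc G.generate_in_carrier \<sigma> by blast
      then show ?thesis
        using Suc.IH unfolding mult[OF \<sigma> \<open>?g \<in> carrier ?G\<close>] by (auto simp: compose_def \<sigma>_def)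
    qed
    moreover have "\<forall>x\<in>S. (f ^^ Suc t) x \<in> S" using Suc.IH \<open>f ` S = S\<close> by auto
    ultimately show ?case by metis
  qed
  have orb: "orbit ?H (\<lambda>g. g) y = A" if "A \<in> C" "y \<in> A" for A y
  proof
    show "orbit ?H (\<lambda>g. g) y \<subseteq> A"
      using gen[OF that(1)] that(2) by (auto simp: orbit_def carr)
  next
    from cyc[OF that(1)] obtain x p where xp: "p > 0" "A = (\<lambda>t. (f ^^ t) x) ` {..<p}"
      "(f ^^ p) x = x" by auto
    from xp(2) that(2) obtain s where s: "s < p" "y = (f ^^ s) x" by auto
    show "A \<subseteq> orbit ?H (\<lambda>g. g) y"
    proof
      fix z assume "z \<in> A"
      with xp(2) obtain t where t: "t < p" "z = (f ^^ t) x" by auto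
      \<comment> \<open>From \<open>y\<close>, \<open>p - s\<close> steps close the cycle at
        \<open>x\<close>, and \<open>t\<close> more reach \<open>z\<close>. No negative powers
        occur.\<close>
      have "(f ^^ (t + (p - s))) y = (f ^^ (t + (p - s) + s)) x"
        unfolding s(2) by (simp only: funpow_add o_apply)
      also have "t + (p - s) + s = t + p" using s(1) by simp
      also have "(f ^^ (t + p)) x = z" unfolding t(2) funpow_add o_apply xp(3) ..
      finally have "z = (\<lambda>x\<in>S. (f ^^ (t + (p - s))) x) y"
        using AS[OF that(1)] that(2) by auto
      then show "z \<in> orbit ?H (\<lambda>g. g) y"
        using pow[of "t + (p - s)"] unfolding orbit_def carr by blast
    qed
  qed
  have ne: "A \<noteq> {}" if "A \<in> C" for A using cyc[OF that] by auto
  have "orbits ?H S (\<lambda>g. g) = C"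
  proof
    show "orbits ?H S (\<lambda>g. g) \<subseteq> C" using orb assms(2) by (auto simp: orbits_def)
    show "C \<subseteq> orbits ?H S (\<lambda>g. g)"
    proof
      fix A assume "A \<in> C"
      with ne obtain y where "y \<in> A" by blast
      with orb \<open>A \<in> C\<close> assms(2) show "A \<in> orbits ?H S (\<lambda>g. g)"
        unfolding orbits_def by blast
    qed
  qed
  then show ?thesis by (simp add: \<sigma>_def)
qed

section \<open>One promotion step on the tree\<close>

lemma T_carrier_simps [simp]:
  "Chain i \<in> T_carrier c \<longleftrightarrow> i \<le> c" "U \<in> T_carrier c" "V \<in> T_carrier c" "W \<in> T_carrier c"
  by (auto simp: T_carrier_def)

lemma bex_T_carrier:
  "(\<exists>x\<in>T_carrier c. Q x) \<longleftrightarrow> (\<exists>i\<le>c. Q (Chain i)) \<or> Q U \<or> Q V \<or> Q W"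
  by (auto simp: T_carrier_def)

text \<open>Quantifiers over covers become explicit Hasse neighbours. Chain elements can gain or
  lose a label; the leaves, covered by nothing, can only lose one.\<close>

lemma promo_step_T:
  fixes c :: nat
  defines "step \<equiv> promo_step (T_carrier c) (T_order c)"
  shows
    "step k M (Chain i) =
      (if i \<le> c \<and> M (Chain i) = None \<and>
          (i < c \<and> M (Chain (Suc i)) = Some k \<or> i = 0 \<and> M W = Some k \<or>
           i = c \<and> (M U = Some k \<or> M V = Some k)) then Some k
       else if M (Chain i) = Some k \<and> 0 < i \<and> i \<le> c \<and> M (Chain (i - 1)) = None then None
       else M (Chain i))"
    "step k M U = (if M U = Some k \<and> M (Chain c) = None then None else M U)"
    "step k M V = (if M V = Some k \<and> M (Chain c) = None then None else M V)"
    "step k M W = (if M W = Some k \<and> M (Chain 0) = None then None else M W)"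
proof -
  have up: "(\<exists>y\<in>T_carrier c. covers (T_order c) (Chain i) y \<and> M y = Some k) \<longleftrightarrow>
    (i < c \<and> M (Chain (Suc i)) = Some k \<or> i = 0 \<and> M W = Some k \<or>
           i = c \<and> (M U = Some k \<or> M V = Some k))"
    by (auto simp: T_covers T_hasse_def bex_T_carrier)
  have down: "(\<exists>z\<in>T_carrier c. covers (T_order c) z (Chain i) \<and> M z = None) \<longleftrightarrow>
      0 < i \<and> i \<le> c \<and> M (Chain (i - 1)) = None"
    by (cases i) (auto simp: T_covers T_hasse_def bex_T_carrier)
  show "step k M (Chain i) =
      (if i \<le> c \<and> M (Chain i) = None \<and>
          (i < c \<and> M (Chain (Suc i)) = Some k \<or> i = 0 \<and> M W = Some k \<or>
           i = c \<and> (M U = Some k \<or> M V = Some k)) then Some k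
       else if M (Chain i) = Some k \<and> 0 < i \<and> i \<le> c \<and> M (Chain (i - 1)) = None then None
       else M (Chain i))"
    unfolding step_def promo_step_def up down T_carrier_simps ..
qed (auto simp: promo_step_def step_def T_covers T_hasse_def bex_T_carrier)

section \<open>Increasing labelings and closed forms for the stages of promotion\<close>

definition T_increasing :: "nat \<Rightarrow> (tree_elem \<Rightarrow> nat) \<Rightarrow> bool" where
  "T_increasing c L \<longleftrightarrow> L (Chain 0) = 1 \<and> (\<forall>i<c. L (Chain i) < L (Chain (Suc i))) \<and>
     L (Chain c) < L U \<and> L (Chain c) < L V \<and> 1 < L W"

lemma T_increasing_less:
  assumes "T_increasing c L" "i < j" "j \<le> c"
  shows "L (Chain i) < L (Chain j)"
  using assms(2,3)
proof (induction j)
  case (Suc j)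
  then have "L (Chain j) < L (Chain (Suc j))" using assms(1) by (simp add: T_increasing_def)
  with Suc show ?case by (cases "i = j") auto
qed simp

text \<open>The label passed down to \<open>Chain i\<close> when the slide runs along the chain.
  \<open>W\<close> is left out even at \<open>i = 0\<close>, so that its label can be compared with
  this one.\<close>

definition successor_label :: "nat \<Rightarrow> (tree_elem \<Rightarrow> nat) \<Rightarrow> nat \<Rightarrow> nat" where
  "successor_label c L i = (if i < c then L (Chain (Suc i)) else min (L U) (L V))"

lemma T_increasing_pos:
  assumes "T_increasing c L" "i \<le> c"
  shows "Suc i \<le> L (Chain i)"
  using assms(2)
proof (induction i)
  case 0
  then show ?case using assms(1) by (simp add: T_increasing_def)
next
  case (Suc i)
  then have "L (Chain i) < L (Chain (Suc i))" using assms(1) by (simp add: T_increasing_def)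
  with Suc show ?case by simp
qed

lemma successor_label_gt:
  assumes "T_increasing c L" "i \<le> c"
  shows "L (Chain i) < successor_label c L i"
  using assms by (auto simp: T_increasing_def successor_label_def)

text \<open>The partial labeling once the labels up to \<open>j\<close> are processed, in the regime
  where \<open>W\<close> does not undercut the chain. A chain element is empty from its own label
  until its successor label; a tie at the top empties both \<open>U\<close> and
  \<open>V\<close>.\<close>

definition slide_stage :: "nat \<Rightarrow> (tree_elem \<Rightarrow> nat) \<Rightarrow> nat \<Rightarrow> tree_elem \<Rightarrow> nat option" where
  "slide_stage c L j x =
    (case x of
       Chain i \<Rightarrow>
         if i \<le> c then
           if successor_label c L i \<le> j then Some (successor_label c L i)
           else if L (Chain i) \<le> j then None else Some (L (Chain i))
         else None
     | U \<Rightarrow> if L U \<le> L V \<and> L U \<le> j then None else Some (L U)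
     | V \<Rightarrow> if L V \<le> L U \<and> L V \<le> j then None else Some (L V)
     | W \<Rightarrow> if L W = successor_label c L 0 \<and> L W \<le> j then None else Some (L W))"

lemma slide_stage_Suc:
  assumes inc: "T_increasing c L" and W: "successor_label c L 0 \<le> L W" and j: "1 \<le> j"
  shows "promo_step (T_carrier c) (T_order c) (Suc j) (slide_stage c L j) = slide_stage c L (Suc j)"
proof
  fix x
  note g = successor_label_gt[OF inc]
  have f0: "L (Chain 0) = 1" using inc by (simp add: T_increasing_def)
  have gS: "successor_label c L i = L (Chain (Suc i))" if "i < c" for i
    using that by (simp add: successor_label_def)
  have gc: "successor_label c L c = min (L U) (L V)" by (simp add: successor_label_def)
  let ?S = "slide_stage c L j" and ?g = "successor_label c L"
  have slide_stage_Chain: "slide_stage c L j' (Chain i) =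
      (if ?g i \<le> j' then Some (?g i) else if L (Chain i) \<le> j' then None else Some (L (Chain i)))"
    if "i \<le> c" for i j'
    using that by (simp add: slide_stage_def)
  \<comment> \<open>Everything covering a chain element that has not yet received its new label
    still carries its original label.\<close>
  have up: "(i < c \<and> ?S (Chain (Suc i)) = Some (Suc j) \<or> i = 0 \<and> ?S W = Some (Suc j) \<or>
           i = c \<and> (?S U = Some (Suc j) \<or> ?S V = Some (Suc j))) \<longleftrightarrow> ?g i = Suc j"
    if "i \<le> c" "j < ?g i" for i
  proof -
    have "?S (Chain (Suc i)) = Some (?g i)" if "i < c"
      using that g[of "Suc i"] gS[OF that] \<open>j < ?g i\<close> by (simp add: slide_stage_Chain)
    moreover have "?S W = Some (L W)" if "i = 0"
      using that W \<open>j < ?g i\<close> by (simp add: slide_stage_def)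
    moreover have "?S U = Some (L U)" "?S V = Some (L V)" if "i = c"
      using that \<open>j < ?g i\<close> gc by (auto simp: slide_stage_def)
    ultimately show ?thesis using that W gc by (cases "i = c") auto
  qed
  \<comment> \<open>The element below waits for precisely the label \<open>Suc j\<close>, so it is
    empty when that label comes up.\<close>
  have down: "?S (Chain (i - 1)) = None" if "i \<le> c" "i \<noteq> 0" "L (Chain i) = Suc j" for i
  proof -
    from that(2) obtain i' where "i = Suc i'" by (cases i) auto
    with that show ?thesis using g[of i'] gS[of i'] by (simp add: slide_stage_Chain)
  qed
  show "promo_step (T_carrier c) (T_order c) (Suc j) (slide_stage c L j) x = slide_stage c L (Suc j) x"
  proof (cases x)
    case (Chain i)
show ?thesis
    proof (cases "i \<le> c")
      case False
      then show ?thesis by (simp add: Chain promo_step_T slide_stage_def)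
    next
      case i: True
      consider "?g i \<le> j" | "L (Chain i) \<le> j" "j < ?g i" | "j < L (Chain i)" by linarith
      then show ?thesis
      proof cases
        case 1
        then show ?thesis using i by (simp add: Chain promo_step_T slide_stage_Chain)
      next
        case 2
        then show ?thesis using i up[OF i 2(2)]
          by (simp add: Chain promo_step_T slide_stage_Chain le_Suc_eq)
      next
        case 3
        \<comment> \<open>The bottom has label 1, already erased at every stage
          \<open>j \<ge> 1\<close>.\<close>
        with f0 j have "i \<noteq> 0" by (cases "i = 0") auto
        then show ?thesis using i 3 g[OF i] down[OF i]
          by (simp add: Chain promo_step_T slide_stage_Chain)
      qed
    qed
  next
    case U
    then show ?thesis using g[of c] gc
      by (auto simp: promo_step_T slide_stage_def min_def)
  next
    case V
    then show ?thesis using g[of c] gc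
      by (auto simp: promo_step_T slide_stage_def min_def)
  next
    case W
    then show ?thesis using g[of 0] f0 j assms(2)
      by (auto simp: promo_step_T slide_stage_def)
  qed
qed

text \<open>The other regime: \<open>W\<close> alone has the least label above the bottom, so the
  empty place jumps from \<open>Chain 0\<close> to the leaf \<open>W\<close> and stays
  there.\<close>

definition branch_stage :: "nat \<Rightarrow> (tree_elem \<Rightarrow> nat) \<Rightarrow> nat \<Rightarrow> tree_elem \<Rightarrow> nat option" where
  "branch_stage c L j x =
    (if x \<notin> T_carrier c then None
     else if x = Chain 0 then (if L W \<le> j then Some (L W) else None)
     else if x = W \<and> L W \<le> j then None else Some (L x))"

lemma branch_stage_Suc:
  assumes inc: "T_increasing c L" and W: "L W < successor_label c L 0" and j: "1 \<le> j"
  shows "promo_step (T_carrier c) (T_order c) (Suc j) (branch_stage c L j) = branch_stage c L (Suc j)"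
proof
  fix x
  show "promo_step (T_carrier c) (T_order c) (Suc j) (branch_stage c L j) x = branch_stage c L (Suc j) x"
  proof (cases x)
    case (Chain i)
    then show ?thesis using W inc j
      by (cases i) (auto simp: promo_step_T branch_stage_def successor_label_def T_increasing_def)
  qed (use W inc in \<open>auto simp: promo_step_T branch_stage_def successor_label_def T_increasing_def\<close>)
qed

lemma fold_promo_step:
  assumes "\<And>j. 1 \<le> j \<Longrightarrow> promo_step P r (Suc j) (M j) = M (Suc j)" "1 \<le> m"
  shows "fold (promo_step P r) [2..<Suc m] (M 1) = M m"
  using assms(2)
proof (induction m rule: dec_induct)
  case (step m)
  then show ?case using assms(1)[of m] by simp
qed simp

lemma K_promotion_slide:
  assumes inc: "T_increasing c L" and W: "successor_label c L 0 \<le> L W"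
    and m: "\<forall>x\<in>T_carrier c. L x \<le> m"
  shows "K_promotion (T_carrier c) (T_order c) m L =
    (\<lambda>x\<in>T_carrier c. case x of
       Chain i \<Rightarrow> successor_label c L i - 1
     | U \<Rightarrow> if L U \<le> L V then m else L U - 1
     | V \<Rightarrow> if L V \<le> L U then m else L V - 1
     | W \<Rightarrow> if L W = successor_label c L 0 then m else L W - 1)"
proof -
  have "(\<lambda>x. if x \<in> T_carrier c \<and> L x \<noteq> 1 then Some (L x) else None) = slide_stage c L 1"
  proof
    fix x
    show "(if x \<in> T_carrier c \<and> L x \<noteq> 1 then Some (L x) else None) = slide_stage c L 1 x"
    proof (cases x)
      case (Chain i)
      have "1 < successor_label c L i" if "i \<le> c"
        using T_increasing_pos[OF inc that] successor_label_gt[OF inc that] by simp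
      then show ?thesis
        using T_increasing_pos[OF inc, of i] inc by (auto simp: Chain slide_stage_def)
    qed (use inc T_increasing_pos[OF inc, of c] in \<open>auto simp: slide_stage_def T_increasing_def\<close>)
  qed
  moreover have "1 \<le> m" using bspec[OF m, of "Chain 0"] inc by (simp add: T_increasing_def)
  ultimately have *: "fold (promo_step (T_carrier c) (T_order c)) [2..<Suc m]
     (\<lambda>x. if x \<in> T_carrier c \<and> L x \<noteq> 1 then Some (L x) else None) = slide_stage c L m"
    using fold_promo_step[of "T_carrier c" "T_order c" "slide_stage c L"] slide_stage_Suc[OF inc W] by simp
  \<comment> \<open>Hence after stage \<open>m\<close> the whole chain is refilled and only leaves
    are empty.\<close>
  have "successor_label c L i \<le> m" if "i \<le> c" for i
    using m by (auto simp: successor_label_def min_le_iff_disj)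
  then show ?thesis
    unfolding K_promotion_def Let_def *
    using m by (auto simp: slide_stage_def fun_eq_iff restrict_def split: tree_elem.splits)
qed

lemma K_promotion_branch:
  assumes inc: "T_increasing c L" and W: "L W < successor_label c L 0"
    and m: "\<forall>x\<in>T_carrier c. L x \<le> m"
  shows "K_promotion (T_carrier c) (T_order c) m L =
    (\<lambda>x\<in>T_carrier c. if x = Chain 0 then L W - 1 else if x = W then m else L x - 1)"
proof -
  have "(\<lambda>x. if x \<in> T_carrier c \<and> L x \<noteq> 1 then Some (L x) else None) = branch_stage c L 1"
  proof
    fix x
    show "(if x \<in> T_carrier c \<and> L x \<noteq> 1 then Some (L x) else None) = branch_stage c L 1 x"
    proof (cases x)
      case (Chain i)
      then show ?thesis
        using T_increasing_pos[OF inc, of i] inc by (auto simp: branch_stage_def T_increasing_def)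
    qed (use inc T_increasing_pos[OF inc, of c] in \<open>auto simp: branch_stage_def T_increasing_def\<close>)
  qed
  moreover have "1 \<le> m" using bspec[OF m, of "Chain 0"] inc by (simp add: T_increasing_def)
  ultimately have *: "fold (promo_step (T_carrier c) (T_order c)) [2..<Suc m]
     (\<lambda>x. if x \<in> T_carrier c \<and> L x \<noteq> 1 then Some (L x) else None) = branch_stage c L m"
    using fold_promo_step[of "T_carrier c" "T_order c" "branch_stage c L"] branch_stage_Suc[OF inc W] by simp
  show ?thesis
    unfolding K_promotion_def Let_def *
    using m by (auto simp: branch_stage_def fun_eq_iff restrict_def)
qed

section \<open>The packed labelings of the tree\<close>

text \<open>Deleting \<open>W\<close> leaves a chain with two tops \<open>U\<close>, \<open>V\<close>, labeled \<open>c + 2 + p\<close> and \<open>c + 2 + q\<close>;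
  the leaf \<open>W\<close> with label \<open>k\<close> is then put back, shifting the labels from \<open>k\<close> on
  if \<open>d\<close> (\<open>W\<close> has a label of its own).\<close>

definition T_labeling :: "nat \<Rightarrow> bool \<Rightarrow> nat \<Rightarrow> nat \<Rightarrow> nat \<Rightarrow> tree_elem \<Rightarrow> nat" where
  "T_labeling c d p q k =
    (let sh = (\<lambda>v. if d \<and> k \<le> v then Suc v else v)
     in (\<lambda>x\<in>T_carrier c. case x of Chain i \<Rightarrow> sh (Suc i) | U \<Rightarrow> sh (c + 2 + p) | V \<Rightarrow> sh (c + 2 + q) | W \<Rightarrow> k))"

definition T_shape :: "nat \<Rightarrow> nat \<Rightarrow> bool \<Rightarrow> nat \<Rightarrow> nat \<Rightarrow> bool" where
  "T_shape c m d p q \<longleftrightarrow> p + q \<le> 1 \<and> m = c + 2 + p + q + of_bool d"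

lemma T_labeling_simps:
  "T_labeling c d p q k (Chain i) = (if i \<le> c then if d \<and> k \<le> Suc i then i + 2 else Suc i else undefined)"
  "T_labeling c d p q k U = (if d \<and> k \<le> c + 2 + p then c + 3 + p else c + 2 + p)"
  "T_labeling c d p q k V = (if d \<and> k \<le> c + 2 + q then c + 3 + q else c + 2 + q)"
  "T_labeling c d p q k W = k"
  by (auto simp: T_labeling_def Let_def)

lemma T_labeling_le:
  assumes "T_shape c m d p q" "k \<le> m"
  shows "\<forall>x\<in>T_carrier c. T_labeling c d p q k x \<le> m"
proof
  fix x assume "x \<in> T_carrier c"
  with assms show "T_labeling c d p q k x \<le> m"
    by (cases x) (auto simp: T_labeling_simps T_shape_def)
qed

lemma T_increasing_T_labeling:
  assumes "2 \<le> k"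
  shows "T_increasing c (T_labeling c d p q k)"
  using assms by (auto simp: T_labeling_simps T_increasing_def)

lemma successor_label_T_labeling:
  assumes "T_shape c m d p q" "i \<le> c"
  shows "successor_label c (T_labeling c d p q k) i = (if d \<and> k \<le> i + 2 then i + 3 else i + 2)"
  using assms by (auto simp: T_labeling_simps successor_label_def T_shape_def)

text \<open>When \<open>d\<close> holds and \<open>k = 2\<close> the branch regime leaves
  \<open>U\<close> and \<open>V\<close> in order; in all other cases the slide reaches the top and
  exchanges \<open>p\<close> and \<open>q\<close>. This includes \<open>k = 2\<close> with
  \<open>d\<close> false: for \<open>p \<noteq> q\<close> the promoted labeling there is
  \<open>T_labeling c d q p m\<close>, although the last branch is written with \<open>p q\<close>.
  The two agree only if \<open>p = q\<close>, and the count in \<open>funpow_promo_row\<close>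
  relies on the exchange.\<close>

lemma K_promotion_T_labeling:
  assumes sh: "T_shape c m d p q" and k: "2 \<le> k" "k \<le> m"
  shows "K_promotion (T_carrier c) (T_order c) m (T_labeling c d p q k) =
    (if 2 < k then T_labeling c d q p (k - 1)
     else if d then T_labeling c d p q m else T_labeling c d q p m)"
\<comment> \<open>This is exactly the case where \<open>W\<close> lies strictly below the successor
  label of the bottom, which is then 3 instead of 2.\<close>
proof (cases "d \<and> k = 2")
  case True
  then have "T_labeling c d p q k W < successor_label c (T_labeling c d p q k) 0"
    using successor_label_T_labeling[OF sh, of 0 k] by (simp add: T_labeling_simps)
  note * = K_promotion_branch[OF T_increasing_T_labeling[OF k(1)] this T_labeling_le[OF sh k(2)]]
  show ?thesis
    unfolding * using True sh
    by (auto simp: T_labeling_def fun_eq_iff T_shape_def split: tree_elem.split)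
next
  case False
  then have "successor_label c (T_labeling c d p q k) 0 \<le> T_labeling c d p q k W"
    using successor_label_T_labeling[OF sh, of 0 k] k by (auto simp: T_labeling_simps)
  note * = K_promotion_slide[OF T_increasing_T_labeling[OF k(1)] this T_labeling_le[OF sh k(2)]]
  let ?L = "T_labeling c d p q k"
  let ?L' = "if 2 < k then T_labeling c d q p (k - 1)
     else if d then T_labeling c d p q m else T_labeling c d q p m"
  have "K_promotion (T_carrier c) (T_order c) m ?L x = ?L' x" for x
  proof (cases x)
    case (Chain i)
    then show ?thesis unfolding * using False k successor_label_T_labeling[OF sh, of i k]
      by (auto simp: T_labeling_simps)
  next
    case W
    then show ?thesis unfolding * using False k successor_label_T_labeling[OF sh, of 0 k]
      by (auto simp: T_labeling_simps)
  next
    case U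
    then show ?thesis unfolding * using False k sh
      by (cases d) (auto simp: T_labeling_simps T_shape_def)
  next
    case V
    then show ?thesis unfolding * using False k sh
      by (cases d) (auto simp: T_labeling_simps T_shape_def)
  qed
  then show ?thesis by (simp add: fun_eq_iff)
qed

section \<open>Classification of the packed labelings\<close>

lemma packed_labelings_T_iff:
  "L \<in> packed_labelings (T_carrier c) (T_order c) m \<longleftrightarrow>
    L \<in> extensional (T_carrier c) \<and> L ` T_carrier c = {1..m} \<and> T_increasing c L"
proof
  assume L: "L \<in> packed_labelings (T_carrier c) (T_order c) m"
  then have less: "L x < L y" if "(x, y) \<in> T_order c" "x \<noteq> y" for x y
    using that by (auto simp: packed_labelings_def T_order_def)
  from L have im: "L ` T_carrier c = {1..m}" and ext: "L \<in> extensional (T_carrier c)"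
    by (auto simp: packed_labelings_def PiE_def)
  have "1 \<in> L ` T_carrier c"
    using im by (metis T_carrier_simps(2) atLeastAtMost_iff dual_order.trans imageI order_refl)
  then obtain y where y: "y \<in> T_carrier c" "L y = 1" by auto
  have "y = Chain 0"
  proof (rule ccontr)
    assume "y \<noteq> Chain 0"
    then have "L (Chain 0) < L y"
      using y(1) by (intro less) (auto simp: T_order_iff T_carrier_def)
    moreover have "L (Chain 0) \<in> {1..m}" unfolding im[symmetric] by simp
    ultimately show False using y(2) by simp
  qed
  then have "L (Chain 0) = 1" using y by simp
  moreover from this have "1 < L W" using less[of "Chain 0" W] by (simp add: T_order_iff)
  ultimately have "T_increasing c L"
    using less by (auto simp: T_increasing_def T_order_iff)
  with im ext show "L \<in> extensional (T_carrier c) \<and> L ` T_carrier c = {1..m} \<and> T_increasing c L"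
    by simp
next
  assume L: "L \<in> extensional (T_carrier c) \<and> L ` T_carrier c = {1..m} \<and> T_increasing c L"
  then have chain: "L (Chain i) < L (Chain j)" if "i < j" "j \<le> c" for i j
    using that T_increasing_less by blast
  have top: "L (Chain i) < L U" "L (Chain i) < L V" if "i \<le> c" for i
    using chain[of i c] L that by (cases "i = c"; auto simp: T_increasing_def)+
  show "L \<in> packed_labelings (T_carrier c) (T_order c) m"
    using L chain top
    by (auto simp: packed_labelings_def PiE_iff T_order_iff T_increasing_def le_less)
qed

text \<open>A value skipped on the chain could only be taken by \<open>U\<close> or
  \<open>V\<close>, which exceed the whole chain. Above the chain only two elements remain, so at
  most two further labels.\<close>

lemma chain_gap_free:
  assumes inc: "T_increasing c L" and im: "L ` (T_carrier c - {W}) = {1..m}"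
  shows "\<And>i. i \<le> c \<Longrightarrow> L (Chain i) = Suc i"
    and "\<exists>p q. p + q \<le> 1 \<and> L U = c + 2 + p \<and> L V = c + 2 + q \<and> m = c + 2 + p + q"
proof -
  have mono: "L (Chain i) \<le> L (Chain j)" if "i \<le> j" "j \<le> c" for i j
    using T_increasing_less[OF inc, of i j] that by (cases "i = j") auto
  have top: "L (Chain c) < L U" "L (Chain c) < L V" using inc by (auto simp: T_increasing_def)
  have mem: "L x \<in> {1..m}" if "x \<in> T_carrier c" "x \<noteq> W" for x
    using im that by blast
  have ex: "(\<exists>i\<le>c. v = L (Chain i)) \<or> v = L U \<or> v = L V" if "v \<in> {1..m}" for v
    using that unfolding im[symmetric] by (auto simp: T_carrier_def)
  show chain: "L (Chain i) = Suc i" if "i \<le> c" for i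
    using that
  proof (induction i rule: less_induct)
    case (less i)
    show ?case
    proof (rule ccontr)
      assume "L (Chain i) \<noteq> Suc i"
      with T_increasing_pos[OF inc less.prems] have gt: "Suc i < L (Chain i)" by simp
      then have "Suc i \<in> {1..m}" using mem[of "Chain i"] less.prems by simp
      from ex[OF this] show False
      proof (elim disjE exE conjE)
        fix j assume j: "j \<le> c" "Suc i = L (Chain j)"
        show False
        proof (cases "j < i")
          case True
          then show False using less.IH[of j] j by simp
        next
          case False
          then show False using mono[of i j] j gt by simp
        qed
      qed (use top mono[of i c] less.prems gt in auto)
    qed
  qed
  have ch: "L (Chain c) = c + 1" using chain by simp
  have up: "v \<le> c + 1 \<or> v = L U \<or> v = L V" if "v \<in> {1..m}" for v
    using ex[OF that] chain by auto
  have "L U \<in> {1..m}" "L V \<in> {1..m}" using mem by simp_all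
  then have bounds: "c + 2 \<le> L U" "L U \<le> m" "c + 2 \<le> L V" "L V \<le> m" using top ch by auto
  \<comment> \<open>These values exceed the chain labels, so a leaf must take each of them.\<close>
  then have "c + 2 = L U \<or> c + 2 = L V" "m = L U \<or> m = L V" "m = c + 2 \<or> c + 3 = L U \<or> c + 3 = L V"
    using up[of "c + 2"] up[of m] up[of "c + 3"] by auto
  then consider "L U = c + 2" "L V = c + 2" "m = c + 2" | "L U = c + 2" "L V = c + 3" "m = c + 3"
    | "L U = c + 3" "L V = c + 2" "m = c + 3"
    using bounds by linarith
  then show "\<exists>p q. p + q \<le> 1 \<and> L U = c + 2 + p \<and> L V = c + 2 + q \<and> m = c + 2 + p + q"
  proof cases
    case 1
    then show ?thesis by (intro exI[of _ 0]) simp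
  next
    case 2
    then show ?thesis by (intro exI[of _ 0] exI[of _ 1]) simp
  next
    case 3
    then show ?thesis by (intro exI[of _ 1] exI[of _ 0]) simp
  qed
qed

lemma T_labeling_packed:
  assumes sh: "T_shape c m d p q" and k: "2 \<le> k" "k \<le> m"
  shows "T_labeling c d p q k \<in> packed_labelings (T_carrier c) (T_order c) m"
proof -
  let ?L = "T_labeling c d p q k"
  have pos: "1 \<le> ?L x" if "x \<in> T_carrier c" for x
    using that k by (cases x) (auto simp: T_labeling_simps)
  have "v \<in> ?L ` T_carrier c" if v: "v \<in> {1..m}" for v
  proof (cases "v = k")
    case True
    then show ?thesis by (intro image_eqI[of _ _ W]) (auto simp: T_labeling_simps)
  next
    case False
    \<comment> \<open>Undoes the shift caused by \<open>W\<close>; the preimage of \<open>v\<close>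
      is then read off from \<open>b\<close>.\<close>
    define b where "b = (if d \<and> k \<le> v then v - 1 else v)"
    have b: "v = (if d \<and> k \<le> b then Suc b else b)" "1 \<le> b" "b \<le> c + 2 + p + q"
      using False v k sh by (cases d; auto simp: b_def T_shape_def)+
    consider "b \<le> c + 1" | "b = c + 2 + p" | "b = c + 2 + q"
      using b sh by (force simp: T_shape_def)
    then show ?thesis
    proof cases
      case 1
      then show ?thesis using b by (intro image_eqI[of _ _ "Chain (b - 1)"]) (auto simp: T_labeling_simps)
    next
      case 2
      then show ?thesis using b by (intro image_eqI[of _ _ U]) (auto simp: T_labeling_simps)
    next
      case 3
      then show ?thesis using b by (intro image_eqI[of _ _ V]) (auto simp: T_labeling_simps)
    qed
  qed
  then have "?L ` T_carrier c = {1..m}"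
    using pos T_labeling_le[OF sh k(2)] by auto
  then show ?thesis
    using T_increasing_T_labeling[OF k(1)] by (simp add: packed_labelings_T_iff T_labeling_def Let_def)
qed

text \<open>Remove \<open>W\<close>, close the gap at its label if no other element has that label,
  and apply \<open>chain_gap_free\<close> to what is left.\<close>

lemma packed_labeling_cases:
  assumes "L \<in> packed_labelings (T_carrier c) (T_order c) m"
  obtains d p q k where "T_shape c m d p q" "2 \<le> k" "k \<le> m" "L = T_labeling c d p q k"
proof -
  from assms have ext: "L \<in> extensional (T_carrier c)" and im: "L ` T_carrier c = {1..m}"
    and inc: "T_increasing c L" by (auto simp: packed_labelings_T_iff)
  define k where "k = L W"
  define B where "B = L ` (T_carrier c - {W})"
  define d where "d \<longleftrightarrow> k \<notin> B"
  have "L W \<in> {1..m}" unfolding im[symmetric] by simp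
  then have k: "2 \<le> k" "k \<le> m" using inc by (auto simp: k_def T_increasing_def)
  have "T_carrier c = insert W (T_carrier c - {W})" by auto
  then have kB: "insert k B = {1..m}" unfolding B_def k_def im[symmetric] by blast
  define L' where "L' x = (if d \<and> k < L x then L x - 1 else L x)" for x
  have L: "L x = (if d \<and> k \<le> L' x then Suc (L' x) else L' x)" if "x \<in> T_carrier c - {W}" for x
  proof -
    have "d \<Longrightarrow> L x \<noteq> k" using that by (auto simp: d_def B_def)
    then show ?thesis by (auto simp: L'_def)
  qed
  \<comment> \<open>Closing the gap makes the labels an initial segment again, one shorter if
    \<open>W\<close> was alone.\<close>
  have im': "L' ` (T_carrier c - {W}) = {1..m - of_bool d}"
  proof -
    have "L' ` (T_carrier c - {W}) = (\<lambda>v. if d \<and> k < v then v - 1 else v) ` B"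
      unfolding B_def image_image by (rule image_cong) (simp_all add: L'_def)
    also have "\<dots> = {1..m - of_bool d}"
    proof (cases d)
      case True
      then have B: "B = {1..m} - {k}" using kB by (auto simp: d_def)
      have "v \<in> (\<lambda>v. if k < v then v - 1 else v) ` B" if "v \<in> {1..m - 1}" for v
      proof (cases "v < k")
        case True
        then show ?thesis using that k by (intro image_eqI[of _ _ v]) (auto simp: B)
      next
        case False
        then show ?thesis using that k by (intro image_eqI[of _ _ "Suc v"]) (auto simp: B)
      qed
      moreover have "(if k < v then v - 1 else v) \<in> {1..m - 1}" if "v \<in> B" for v
        using that k by (auto simp: B)
      ultimately have "(\<lambda>v. if k < v then v - 1 else v) ` B = {1..m - 1}" by blast
      then show ?thesis by (simp only: True simp_thms of_bool_eq)
    next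
      case False
      then show ?thesis using kB by (auto simp: d_def)
    qed
    finally show ?thesis .
  qed
  have strict: "L' x < L' y" if "x \<in> T_carrier c - {W}" "y \<in> T_carrier c - {W}" "L x < L y" for x y
    using L[OF that(1)] L[OF that(2)] that(3) by (auto split: if_splits)
  have "T_increasing c L'"
    using inc k strict[of "Chain c" U] strict[of "Chain c" V] strict[of "Chain _" "Chain (Suc _)"]
    by (auto simp: T_increasing_def L'_def[of "Chain 0"] L'_def[of W] k_def)
  note gap = chain_gap_free[OF this im']
  from gap(2) obtain p q where pq: "p + q \<le> 1" "L' U = c + 2 + p" "L' V = c + 2 + q"
    "m - of_bool d = c + 2 + p + q" by auto
  have sh: "T_shape c m d p q"
    using pq k by (cases d) (auto simp: T_shape_def)
  have "L x = T_labeling c d p q k x" for x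
  proof (cases "x \<in> T_carrier c")
    case True
    then show ?thesis using L[of x] gap(1) pq
      by (cases x) (auto simp: T_labeling_simps k_def)
  next
    case False
    then show ?thesis using ext by (simp add: T_labeling_def Let_def extensional_def)
  qed
  then show thesis using that[OF sh k] by blast
qed

section \<open>Orbits\<close>

abbreviation promo :: "nat \<Rightarrow> nat \<Rightarrow> (tree_elem \<Rightarrow> nat) \<Rightarrow> (tree_elem \<Rightarrow> nat)" where
  "promo c m \<equiv> K_promotion (T_carrier c) (T_order c) m"

text \<open>One full turn of the label of \<open>W\<close>, from \<open>m\<close> down to 2.\<close>

definition promo_row :: "nat \<Rightarrow> nat \<Rightarrow> bool \<Rightarrow> nat \<Rightarrow> nat \<Rightarrow> (tree_elem \<Rightarrow> nat) set" where
  "promo_row c m d p q = (\<lambda>t. (promo c m ^^ t) (T_labeling c d p q m)) ` {..<m - 1}"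

lemma T_shape_swap: "T_shape c m d p q \<Longrightarrow> T_shape c m d q p"
  by (auto simp: T_shape_def)

lemma funpow_promo:
  assumes "T_shape c m d p q" "t < m - 1"
  shows "(promo c m ^^ t) (T_labeling c d p q m) =
    (if even t then T_labeling c d p q (m - t) else T_labeling c d q p (m - t))"
  using assms(2)
proof (induction t)
  case (Suc t)
  then have "2 \<le> m - t" "m - t \<le> m" "2 < m - t" by auto
  then show ?case
    using Suc K_promotion_T_labeling[OF assms(1), of "m - t"]
      K_promotion_T_labeling[OF T_shape_swap[OF assms(1)], of "m - t"] by auto
qed simp

text \<open>The first \<open>m - 2\<close> steps all swap \<open>p\<close> and \<open>q\<close>. If
  \<open>p \<noteq> q\<close>, these are \<open>c + 1\<close> swaps for \<open>d\<close> false,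
  where the last step swaps too, and \<open>c + 2\<close> for \<open>d\<close> true, where it does
  not. Both totals are \<open>c + 2\<close>.\<close>

lemma funpow_promo_row:
  assumes sh: "T_shape c m d p q"
  shows "(promo c m ^^ (m - 1)) (T_labeling c d p q m) =
    (if even c then T_labeling c d p q m else T_labeling c d q p m)"
proof -
  have m: "2 \<le> m" "m - 1 = Suc (m - 2)" using sh by (auto simp: T_shape_def)
  consider "p = 0" "q = 0" | "p = 0" "q = 1" | "p = 1" "q = 0"
    using sh by (force simp: T_shape_def)
  then show ?thesis
    unfolding m(2) funpow.simps o_apply
    using funpow_promo[OF sh, of "m - 2"] K_promotion_T_labeling[OF sh, of 2] m
      K_promotion_T_labeling[OF T_shape_swap[OF sh], of 2] sh
    by cases (auto simp: T_shape_def)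
qed

lemma promo_row_eq:
  assumes "T_shape c m d p q"
  shows "promo_row c m d p q =
    (\<lambda>t. if even t then T_labeling c d p q (m - t) else T_labeling c d q p (m - t)) ` {..<m - 1}"
  unfolding promo_row_def by (intro image_cong refl funpow_promo[OF assms]) simp

lemma card_promo_row:
  assumes "T_shape c m d p q"
  shows "card (promo_row c m d p q) = m - 1"
proof -
  have "inj_on (\<lambda>t. if even t then T_labeling c d p q (m - t) else T_labeling c d q p (m - t)) {..<m - 1}"
    (is "inj_on ?f _")
  proof (rule inj_onI)
    fix s t assume st: "s \<in> {..<m - 1}" "t \<in> {..<m - 1}" "?f s = ?f t"
    have "?f s W = m - s" "?f t W = m - t" by (simp_all add: T_labeling_simps)
    with st show "s = t" by simp
  qed
  then show ?thesis unfolding promo_row_eq[OF assms] by (simp only: card_image card_lessThan)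
qed

text \<open>\<open>m - L W\<close> counts the steps since the start of the row, so its parity
  recovers the initial order of \<open>U\<close> and \<open>V\<close> from any member.\<close>

lemma promo_row_order:
  assumes "T_shape c m d p q" "L \<in> promo_row c m d p q"
  shows "L U < L V \<longleftrightarrow> (if even (m - L W) then p < q else q < p)"
    "L V < L U \<longleftrightarrow> (if even (m - L W) then q < p else p < q)"
proof -
  have less: "T_labeling c d p' q' k U < T_labeling c d p' q' k V \<longleftrightarrow> p' < q'"
    "T_labeling c d p' q' k V < T_labeling c d p' q' k U \<longleftrightarrow> q' < p'" for p' q' k
    by (auto simp: T_labeling_simps)
  obtain t where t: "t < m - 1"
    and L: "L = (if even t then T_labeling c d p q (m - t) else T_labeling c d q p (m - t))"
    using assms by (auto simp: promo_row_eq)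
  then have "m - L W = t" by (simp add: T_labeling_simps)
  then show "L U < L V \<longleftrightarrow> (if even (m - L W) then p < q else q < p)"
    "L V < L U \<longleftrightarrow> (if even (m - L W) then q < p else p < q)"
    by (simp_all add: L less)
qed

lemma promo_row_disjoint:
  assumes "T_shape c m d p q" "T_shape c m d' p' q'" "(p, q) \<noteq> (p', q')"
  shows "promo_row c m d p q \<inter> promo_row c m d' p' q' = {}"
proof (rule ccontr)
  assume "promo_row c m d p q \<inter> promo_row c m d' p' q' \<noteq> {}"
  then obtain L where "L \<in> promo_row c m d p q" "L \<in> promo_row c m d' p' q'" by blast
  then have "p < q \<longleftrightarrow> p' < q'" "q < p \<longleftrightarrow> q' < p'"
    using promo_row_order[OF assms(1), of L] promo_row_order[OF assms(2), of L]
    by (auto split: if_splits)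
  \<comment> \<open>Since \<open>p + q \<le> 1\<close>, the pair is determined by which entry is
    larger.\<close>
  with assms show False by (auto simp: T_shape_def)
qed

lemma promo_row_ne:
  assumes "T_shape c m d p q" "T_shape c m d' p' q'" "(p, q) \<noteq> (p', q')"
  shows "promo_row c m d p q \<noteq> promo_row c m d' p' q'"
proof -
  have "0 < m - 1" using assms(1) by (simp add: T_shape_def)
  then have "promo_row c m d p q \<noteq> {}" using card_promo_row[OF assms(1)] by auto
  with promo_row_disjoint[OF assms] show ?thesis by auto
qed

lemma packed_labelings_rows:
  "packed_labelings (T_carrier c) (T_order c) m =
    \<Union>{promo_row c m d p q |d p q. T_shape c m d p q}"
proof (intro equalityI subsetI)
  fix L assume "L \<in> packed_labelings (T_carrier c) (T_order c) m"
  then obtain d p q k where sh: "T_shape c m d p q" and k: "2 \<le> k" "k \<le> m"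
    and L: "L = T_labeling c d p q k" by (rule packed_labeling_cases)
  have t: "m - k \<in> {..<m - 1}" "m - (m - k) = k" using k by auto
  show "L \<in> \<Union>{promo_row c m d p q |d p q. T_shape c m d p q}"
  proof (cases "even (m - k)")
    case True
    then have "L \<in> promo_row c m d p q"
      unfolding promo_row_eq[OF sh] L by (intro image_eqI[OF _ t(1)]) (simp add: t(2))
    with sh show ?thesis by blast
  next
    case False
    \<comment> \<open>An odd number of swaps precedes \<open>L\<close>, so its row starts with the
      opposite order.\<close>
    then have "L \<in> promo_row c m d q p"
      unfolding promo_row_eq[OF T_shape_swap[OF sh]] L by (intro image_eqI[OF _ t(1)]) (simp add: t(2))
    with T_shape_swap[OF sh] show ?thesis by blast
  qed
next
  fix L assume "L \<in> \<Union>{promo_row c m d p q |d p q. T_shape c m d p q}"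
  then obtain d p q where sh: "T_shape c m d p q" and "L \<in> promo_row c m d p q" by blast
  then obtain t where "t < m - 1"
    "L = (if even t then T_labeling c d p q (m - t) else T_labeling c d q p (m - t))"
    by (auto simp: promo_row_eq)
  then show "L \<in> packed_labelings (T_carrier c) (T_order c) m"
    using T_labeling_packed[OF sh, of "m - t"] T_labeling_packed[OF T_shape_swap[OF sh], of "m - t"]
    by auto
qed

section \<open>Rows assembled into orbits\<close>

definition is_cycle :: "('a \<Rightarrow> 'a) \<Rightarrow> 'a set \<Rightarrow> bool" where
  "is_cycle f A \<longleftrightarrow> (\<exists>x p. p > 0 \<and> A = (\<lambda>t. (f ^^ t) x) ` {..<p} \<and> (f ^^ p) x = x)"

lemma promo_row_cycle:
  assumes sh: "T_shape c m d p q" and "even c \<or> p = q"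
  shows "is_cycle (promo c m) (promo_row c m d p q)"
proof -
  have "0 < m - 1" using sh by (simp add: T_shape_def)
  moreover have "(promo c m ^^ (m - 1)) (T_labeling c d p q m) = T_labeling c d p q m"
    using funpow_promo_row[OF sh] assms(2) by auto
  ultimately show ?thesis unfolding is_cycle_def promo_row_def by blast
qed

text \<open>For odd \<open>c\<close> each row continues into the start of the swapped row, so the
  two concatenate to one closed walk.\<close>

lemma promo_row_double_cycle:
  assumes sh: "T_shape c m d p q" and "odd c"
  shows "is_cycle (promo c m) (promo_row c m d p q \<union> promo_row c m d q p)"
proof -
  let ?f = "promo c m"
  let ?x = "T_labeling c d p q m" and ?y = "T_labeling c d q p m"
  have m: "0 < m - 1" using sh by (simp add: T_shape_def)
  have xy: "(?f ^^ (m - 1)) ?x = ?y" "(?f ^^ (m - 1)) ?y = ?x"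
    using funpow_promo_row[OF sh] funpow_promo_row[OF T_shape_swap[OF sh]] assms(2) by auto
  have two: "2 * (m - 1) = (m - 1) + (m - 1)" by simp
  have "(?f ^^ (2 * (m - 1))) ?x = ?x"
    unfolding two funpow_add o_apply xy ..
  moreover have "promo_row c m d p q \<union> promo_row c m d q p = (\<lambda>t. (?f ^^ t) ?x) ` {..<2 * (m - 1)}"
  proof -
    have "{..<2 * (m - 1)} = {..<m - 1} \<union> (\<lambda>t. t + (m - 1)) ` {..<m - 1}"
      unfolding lessThan_atLeast0 image_add_atLeastLessThan' by auto
    then show ?thesis
      unfolding promo_row_def by (simp only: image_Un image_image funpow_add o_apply xy)
  qed
  moreover have "0 < 2 * (m - 1)" using m by simp
  ultimately show ?thesis unfolding is_cycle_def by blast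
qed

lemma card_promo_row_union:
  assumes "T_shape c m d p q" "p \<noteq> q"
  shows "card (promo_row c m d p q \<union> promo_row c m d q p) = 2 * (m - 1)"
proof -
  have "finite (promo_row c m d p q)" "finite (promo_row c m d q p)" by (simp_all add: promo_row_def)
  then show ?thesis
    using promo_row_disjoint[OF assms(1) T_shape_swap[OF assms(1)]] assms
    by (simp add: card_Un_disjoint card_promo_row T_shape_swap)
qed

lemma promotion_orbits_eqI:
  assumes "\<Union>C = packed_labelings (T_carrier c) (T_order c) m"
    and "\<And>A. A \<in> C \<Longrightarrow> is_cycle (promo c m) A"
  shows "promotion_orbits (T_carrier c) (T_order c) m = C"
proof -
  have "finite (T_carrier c)" by (simp add: T_carrier_def)
  then have "finite (packed_labelings (T_carrier c) (T_order c) m)"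
    by (rule finite_subset[rotated, OF finite_PiE[of _ "\<lambda>_. {1..m}"]])
      (auto simp: packed_labelings_def)
  then show ?thesis
    unfolding promotion_orbits_def Let_def
    by (rule orbits_cyclic) (use assms in \<open>auto simp: is_cycle_def\<close>)
qed

lemma card_T_carrier: "card (T_carrier c) = c + 4"
proof -
  have "card (Chain ` {0..c}) = c + 1" by (subst card_image) (auto simp: inj_on_def)
  moreover have "card {U, V, W} = 3" by simp
  moreover have "Chain ` {0..c} \<inter> {U, V, W} = {}" by auto
  ultimately show ?thesis unfolding T_carrier_def by (subst card_Un_disjoint) auto
qed

theorem theorem5p1:
  fixes c n m :: nat and \<Omega> :: "(tree_elem \<Rightarrow> nat) set set"
  assumes n: "n = card (T_carrier c)"
    and \<Omega>: "\<Omega> = promotion_orbits (T_carrier c) (T_order c) m"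
  shows "n = c + 4 \<and>
    (m = n - 2 \<longrightarrow> card \<Omega> = 1 \<and> (\<forall>A\<in>\<Omega>. card A = m - 1)) \<and>
    (m = n - 1 \<longrightarrow>
       (even c \<longrightarrow> card \<Omega> = 3 \<and> (\<forall>A\<in>\<Omega>. card A = m - 1)) \<and>
       (odd c \<longrightarrow> (\<exists>A B. A \<noteq> B \<and> \<Omega> = {A, B} \<and>
                    card A = m - 1 \<and> card B = 2 * (m - 1)))) \<and>
    (m = n \<longrightarrow>
       (even c \<longrightarrow> card \<Omega> = 2 \<and> (\<forall>A\<in>\<Omega>. card A = m - 1)) \<and>
       (odd c \<longrightarrow> card \<Omega> = 1 \<and> (\<forall>A\<in>\<Omega>. card A = 2 * (m - 1))))"
proof -
  have n4: "n = c + 4" using n card_T_carrier by simp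
  let ?R = "promo_row c m"
  let ?rows = "{?R d p q |d p q. T_shape c m d p q}"
  have a: "card \<Omega> = 1 \<and> (\<forall>A\<in>\<Omega>. card A = m - 1)" if m: "m = n - 2"
  proof -
    \<comment> \<open>With \<open>c + 2\<close> labels, \<open>U\<close> and \<open>V\<close> tie
      and \<open>W\<close> shares its label.\<close>
    have sh: "T_shape c m d p q \<longleftrightarrow> \<not> d \<and> p = 0 \<and> q = 0" for d p q
      using m n4 by (auto simp: T_shape_def)
    have "?rows = {?R False 0 0}" unfolding sh by auto
    note rows = packed_labelings_rows[of c m, unfolded this]
    have "\<Omega> = {?R False 0 0}"
      unfolding \<Omega> by (rule promotion_orbits_eqI) (auto simp: rows sh intro: promo_row_cycle)
    then show ?thesis by (simp add: card_promo_row sh)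
  qed
  have b: "(even c \<longrightarrow> card \<Omega> = 3 \<and> (\<forall>A\<in>\<Omega>. card A = m - 1)) \<and>
       (odd c \<longrightarrow> (\<exists>A B. A \<noteq> B \<and> \<Omega> = {A, B} \<and> card A = m - 1 \<and> card B = 2 * (m - 1)))"
    if m: "m = n - 1"
  proof -
    \<comment> \<open>One label more: either \<open>W\<close> has its own, or \<open>U\<close> and
      \<open>V\<close> differ.\<close>
    have sh: "T_shape c m d p q \<longleftrightarrow>
        d \<and> p = 0 \<and> q = 0 \<or> \<not> d \<and> p = 0 \<and> q = 1 \<or> \<not> d \<and> p = 1 \<and> q = 0" for d p q
      using m n4 by (cases d) (auto simp: T_shape_def)
    have "?rows = {?R True 0 0, ?R False 0 1, ?R False 1 0}" unfolding sh by auto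
    note rows = packed_labelings_rows[of c m, unfolded this]
    have ev: "card \<Omega> = 3 \<and> (\<forall>A\<in>\<Omega>. card A = m - 1)" if "even c"
    proof -
      have "\<Omega> = {?R True 0 0, ?R False 0 1, ?R False 1 0}"
        unfolding \<Omega>
        by (rule promotion_orbits_eqI)
          (use that in \<open>auto simp: rows sh intro: promo_row_cycle\<close>)
      moreover have "?R True 0 0 \<noteq> ?R False 0 1" "?R True 0 0 \<noteq> ?R False 1 0"
        "?R False 0 1 \<noteq> ?R False 1 0"
        by (rule promo_row_ne; simp add: sh)+
      ultimately show ?thesis by (simp add: card_promo_row sh)
    qed
    have od: "\<exists>A B. A \<noteq> B \<and> \<Omega> = {A, B} \<and> card A = m - 1 \<and> card B = 2 * (m - 1)" if "odd c"
    proof (intro exI conjI)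
      let ?A = "?R True 0 0" and ?B = "?R False 0 1 \<union> ?R False 1 0"
      show "\<Omega> = {?A, ?B}"
        unfolding \<Omega>
        by (rule promotion_orbits_eqI)
          (use that in \<open>auto simp: rows sh intro: promo_row_cycle promo_row_double_cycle\<close>)
      show cA: "card ?A = m - 1" by (simp add: card_promo_row sh)
      show cB: "card ?B = 2 * (m - 1)" by (rule card_promo_row_union) (simp_all add: sh)
      have "0 < m - 1" using m n4 by simp
      with cA cB show "?A \<noteq> ?B" by (metis add_cancel_right_left mult_2 neq0_conv)
    qed
    from ev od show ?thesis by blast
  qed
  have c: "(even c \<longrightarrow> card \<Omega> = 2 \<and> (\<forall>A\<in>\<Omega>. card A = m - 1)) \<and>
       (odd c \<longrightarrow> card \<Omega> = 1 \<and> (\<forall>A\<in>\<Omega>. card A = 2 * (m - 1)))"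
    if m: "m = n"
  proof -
    \<comment> \<open>As many labels as elements: \<open>W\<close> has its own and \<open>U\<close>,
      \<open>V\<close> differ.\<close>
    have sh: "T_shape c m d p q \<longleftrightarrow> d \<and> p = 0 \<and> q = 1 \<or> d \<and> p = 1 \<and> q = 0" for d p q
      using m n4 by (cases d) (auto simp: T_shape_def)
    have "?rows = {?R True 0 1, ?R True 1 0}" unfolding sh by auto
    note rows = packed_labelings_rows[of c m, unfolded this]
    have ev: "card \<Omega> = 2 \<and> (\<forall>A\<in>\<Omega>. card A = m - 1)" if "even c"
    proof -
      have "\<Omega> = {?R True 0 1, ?R True 1 0}"
        unfolding \<Omega>
        by (rule promotion_orbits_eqI)
          (use that in \<open>auto simp: rows sh intro: promo_row_cycle\<close>)
      moreover have "?R True 0 1 \<noteq> ?R True 1 0" by (rule promo_row_ne; simp add: sh)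
      ultimately show ?thesis by (simp add: card_promo_row sh)
    qed
    have od: "card \<Omega> = 1 \<and> (\<forall>A\<in>\<Omega>. card A = 2 * (m - 1))" if "odd c"
    proof -
      have "\<Omega> = {?R True 0 1 \<union> ?R True 1 0}"
        unfolding \<Omega>
        by (rule promotion_orbits_eqI)
          (use that in \<open>auto simp: rows sh intro: promo_row_double_cycle\<close>)
      moreover have "card (?R True 0 1 \<union> ?R True 1 0) = 2 * (m - 1)"
        by (rule card_promo_row_union) (simp_all add: sh)
      ultimately show ?thesis by simp
    qed
    from ev od show ?thesis by blast
  qed
  show ?thesis using n4 a b c by blast
qed

end
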